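(* Let $n\geq 1$ be an integer and let $i\in\{1,2,\ldots,n\}$. Then $\{i\}$ is a driver set for the path graph $P_n$ if and only if $\gcd(i,n+1)=1$. Hence $N_D(P_n)=\phi(n+1)$, where $\phi$ is the Euler totient function.
   Context: $P_n$ is the simple undirected path graph with vertex set $V=\{1,\ldots,n\}$ and edge set $\{\{1,2\},\{2,3\},\ldots,\{n-1,n\}\}$. For a simple undirected graph $G$ on $V=\{1,\ldots,n\}$ with (0-1) adjacency matrix $A$ and a non-empty subset $S=\{i_1,\ldots,i_k\}\subseteq V$, $B_S$ denotes the $(n\times k)$-matrix with columns the standard basis vectors $\mathbf{e}_{i_1},\ldots,\mathbf{e}_{i_k}$. $S$ is called a driver set for $G$ if the linear system $\dot{\mathbf{x}}=A\mathbf{x}+B_S\mathbf{u}$ (the pair $(A,B_S)$) is controllable, i.e. any initial state can be steered to any other state in finite time. $D(G)$ denotes the minimum cardinality of a driver set for $G$; a minimal driver set is a driver set of cardinality $D(G)$, and $N_D(G)$ denotes the number of minimal driver sets for $G$. *)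

theory Defs
  imports Complex_Main "HOL-Number_Theory.Totient" "Jordan_Normal_Form.Matrix"
begin

text \<open>
  A simple graph on the vertex set \<open>{1..n}\<close> is given by \<open>n\<close> and its set \<open>E\<close> of two-element edges.
  Matrix and vector indices are 0-based, so vertex \<open>i\<close> has index \<open>i - 1\<close>.
\<close>

definition path_edges :: "nat \<Rightarrow> nat set set" where
  "path_edges n = {{i, i + 1} | i. 1 \<le> i \<and> i < n}"

definition adjacency_matrix :: "nat \<Rightarrow> nat set set \<Rightarrow> real mat" where
  "adjacency_matrix n E = mat n n (\<lambda>(i, j). if {i + 1, j + 1} \<in> E then 1 else 0)"

definition input_matrix :: "nat \<Rightarrow> nat set \<Rightarrow> real mat" where
  "input_matrix n S = mat_of_cols n (map (\<lambda>i. unit_vec n (i - 1)) (sorted_list_of_set S))"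

text \<open>
  Controls are continuous, so trajectories are classical (continuously differentiable) solutions
  of \<open>x' = A x + B u\<close> on \<open>[0, T]\<close>. Continuity and derivatives are componentwise, since
  \<^typ>\<open>real vec\<close> carries no topology; at the endpoints the derivatives are one-sided.
\<close>

definition admissible_control :: "nat \<Rightarrow> real \<Rightarrow> (real \<Rightarrow> real vec) \<Rightarrow> bool" where
  "admissible_control k T u \<longleftrightarrow>
     (\<forall>t\<in>{0..T}. u t \<in> carrier_vec k) \<and> (\<forall>j<k. continuous_on {0..T} (\<lambda>t. u t $ j))"

definition trajectory ::
  "real mat \<Rightarrow> real mat \<Rightarrow> real \<Rightarrow> (real \<Rightarrow> real vec) \<Rightarrow> (real \<Rightarrow> real vec) \<Rightarrow> bool" where
  "trajectory A B T u x \<longleftrightarrow>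
     (\<forall>t\<in>{0..T}. x t \<in> carrier_vec (dim_row A) \<and>
        (\<forall>i<dim_row A. ((\<lambda>s. x s $ i) has_real_derivative (A *\<^sub>v x t + B *\<^sub>v u t) $ i)
                         (at t within {0..T})))"

definition controllable :: "real mat \<Rightarrow> real mat \<Rightarrow> bool" where
  "controllable A B \<longleftrightarrow>
     (\<forall>x0\<in>carrier_vec (dim_row A). \<forall>x1\<in>carrier_vec (dim_row A).
        \<exists>T>0. \<exists>u x. admissible_control (dim_col B) T u \<and> trajectory A B T u x \<and>
                   x 0 = x0 \<and> x T = x1)"

definition driver_set :: "nat \<Rightarrow> nat set set \<Rightarrow> nat set \<Rightarrow> bool" where
  "driver_set n E S \<longleftrightarrow>
     S \<noteq> {} \<and> S \<subseteq> {1..n} \<and> controllable (adjacency_matrix n E) (input_matrix n S)"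

definition min_driver_card :: "nat \<Rightarrow> nat set set \<Rightarrow> nat" where
  "min_driver_card n E = Min (card ` {S. driver_set n E S})"

definition minimal_driver_set :: "nat \<Rightarrow> nat set set \<Rightarrow> nat set \<Rightarrow> bool" where
  "minimal_driver_set n E S \<longleftrightarrow> driver_set n E S \<and> card S = min_driver_card n E"

definition num_minimal_driver_sets :: "nat \<Rightarrow> nat set set \<Rightarrow> nat" where
  "num_minimal_driver_sets n E = card {S. minimal_driver_set n E S}"

end

theory Submission
  imports Defs "HOL-Computational_Algebra.Polynomial_Factorial"
    "HOL-Computational_Algebra.Field_as_Ring" "Jordan_Normal_Form.Determinant"
begin

text \<open>
  If \<open>d = gcd i (n + 1) > 1\<close>, then \<open>v\<^sub>j = sin (j \<pi> / d)\<close> is an eigenvector of the symmetric matrix \<open>A\<close>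
  that vanishes at \<open>i\<close>, so along every trajectory \<open>v \<bullet> x\<close> satisfies an autonomous linear equation and
  cannot leave \<open>0\<close>.

  If \<open>gcd i (n + 1) = 1\<close>, trajectories are parametrised by a polynomial \<open>z\<close>, a flat output. With
  \<open>p\<close> the characteristic polynomial and \<open>f\<^sub>j\<close> the entries of the \<open>i\<close>-th column of the adjugate of
  \<open>sI - A\<close>, put \<open>x\<^sub>j = f\<^sub>j(d/dt) z\<close> and \<open>u = p(d/dt) z\<close>. The \<open>f\<^sub>j\<close> are products of characteristic
  polynomials of shorter paths, which satisfy a Fibonacci-like gcd property; hence the \<open>f\<^sub>j\<close> are
  linearly independent, and every state is attained by a choice of the derivatives of \<open>z\<close> of order
  less than \<open>n\<close>. Hermite interpolation prescribes these at the times \<open>0\<close> and \<open>1\<close>.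
\<close>

section \<open>Obstruction to controllability\<close>

text \<open>The integrating factor \<open>exp (- c * t)\<close> turns \<open>y\<close> into a
  function with derivative zero.\<close>

lemma has_derivative_linear_imp_zero:
  fixes y :: "real \<Rightarrow> real"
  assumes "0 < T" and y: "\<And>t. t \<in> {0..T} \<Longrightarrow> (y has_real_derivative c * y t) (at t within {0..T})"
    and "y 0 = 0"
  shows "y T = 0"
proof -
  let ?g = "\<lambda>t. exp (- c * t) * y t"
  have g: "(?g has_real_derivative 0) (at t within {0..T})" if "t \<in> {0..T}" for t
    by (rule derivative_eq_intros y[OF that] refl)+ (simp add: algebra_simps)
  have "?g T = ?g 0"
  proof (rule DERIV_isconst2[OF \<open>0 < T\<close>])
    show "continuous_on {0..T} ?g"
      by (rule DERIV_continuous_on[OF g])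
    show "(?g has_real_derivative 0) (at t)" if "0 < t" "t < T" for t
      using g[of t] that by (simp add: at_within_Icc_at)
  qed (use \<open>0 < T\<close> in auto)
  with \<open>y 0 = 0\<close> show ?thesis by simp
qed

text \<open>Whatever the control, \<open>v \<bullet> x\<close> obeys \<open>y' = c * y\<close>.
  Starting from the zero state it stays zero, so the state \<open>v\<close>, with
  \<open>v \<bullet> v > 0\<close>, is out of reach.\<close>

lemma left_eigenvector_imp_not_controllable:
  fixes A B :: "real mat"
  assumes A: "A \<in> carrier_mat n n" and B: "B \<in> carrier_mat n k"
    and v: "v \<in> carrier_vec n" "v \<noteq> 0\<^sub>v n"
    and Av: "transpose_mat A *\<^sub>v v = c \<cdot>\<^sub>v v" and Bv: "transpose_mat B *\<^sub>v v = 0\<^sub>v k"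
  shows "\<not> controllable A B"
proof
  assume "controllable A B"
  then obtain T u x where T: "T > 0" and u: "admissible_control k T u"
    and x: "trajectory A B T u x" "x 0 = 0\<^sub>v n" "x T = v"
    using A B v unfolding controllable_def
    by (metis carrier_matD zero_carrier_vec)
  have xc: "x t \<in> carrier_vec n" if "t \<in> {0..T}" for t
    using x A that by (auto simp: trajectory_def)
  have vx: "v \<bullet> x s = (\<Sum>i = 0..<n. v $ i * x s $ i)" if "s \<in> {0..T}" for s
    using carrier_vecD[OF xc[OF that]] by (simp add: scalar_prod_def)
  have "((\<lambda>s. v \<bullet> x s) has_real_derivative c * (v \<bullet> x t)) (at t within {0..T})"
    if t: "t \<in> {0..T}" for t
  proof -
    have ut: "u t \<in> carrier_vec k"
      using u t by (auto simp: admissible_control_def)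
    let ?d = "A *\<^sub>v x t + B *\<^sub>v u t"
    have d: "A *\<^sub>v x t \<in> carrier_vec n" "B *\<^sub>v u t \<in> carrier_vec n"
      using mult_mat_vec_carrier[OF A xc[OF t]] mult_mat_vec_carrier[OF B ut] .
    have "((\<lambda>s. \<Sum>i = 0..<n. v $ i * x s $ i) has_real_derivative (\<Sum>i = 0..<n. v $ i * ?d $ i))
        (at t within {0..T})"
      using x A t by (intro DERIV_sum DERIV_cmult) (auto simp: trajectory_def)
    then have "((\<lambda>s. \<Sum>i = 0..<n. v $ i * x s $ i) has_real_derivative v \<bullet> ?d) (at t within {0..T})"
      using B by (simp add: scalar_prod_def)
    \<comment> \<open>Outside \<open>{0..T}\<close> the dimension of \<open>x s\<close> is unknown,
      so the sum and the scalar product are exchanged only within the interval.\<close>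
    then have "((\<lambda>s. v \<bullet> x s) has_real_derivative v \<bullet> ?d) (at t within {0..T})"
      by (rule has_field_derivative_transform_within[where d = 1])
        (use t in \<open>simp_all add: vx\<close>)
    moreover have "v \<bullet> ?d = (transpose_mat A *\<^sub>v v) \<bullet> x t + (transpose_mat B *\<^sub>v v) \<bullet> u t"
      using scalar_prod_add_distrib[OF v(1) d] transpose_vec_mult_scalar[OF A xc[OF t] v(1)]
        transpose_vec_mult_scalar[OF B ut v(1)] by simp
    moreover have "\<dots> = c * (v \<bullet> x t)"
      using Av Bv ut v xc[OF t] by simp
    ultimately show ?thesis by simp
  qed
  then have "v \<bullet> v = 0"
    using has_derivative_linear_imp_zero[OF T, of "\<lambda>s. v \<bullet> x s" c] x v by simp
  then have "\<forall>i<n. v $ i = 0"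
    using v by (auto simp: scalar_prod_def sum_nonneg_eq_0_iff)
  with v show False by (auto intro: eq_vecI)
qed

section \<open>The adjacency matrix of the path\<close>

lemma adjacency_matrix_carrier: "adjacency_matrix n E \<in> carrier_mat n n"
  by (simp add: adjacency_matrix_def)

lemma adjacency_matrix_path_index:
  assumes "a < n" "b < n"
  shows "adjacency_matrix n (path_edges n) $$ (a, b) = (if b = a + 1 \<or> a = b + 1 then 1 else 0)"
proof -
  have "{a + 1, b + 1} \<in> path_edges n \<longleftrightarrow> b = a + 1 \<or> a = b + 1"
    using assms unfolding path_edges_def
    by (auto simp: doubleton_eq_iff intro: exI[of _ "Suc a"] exI[of _ "Suc b"])
  then show ?thesis using assms by (simp add: adjacency_matrix_def)
qed

lemma transpose_adjacency_matrix:
  "transpose_mat (adjacency_matrix n E) = adjacency_matrix n E"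
  by (rule eq_matI) (auto simp: adjacency_matrix_def insert_commute)

text \<open>\<open>g\<close> is indexed by vertices, with fictitious vertices \<open>0\<close> and
  \<open>n + 1\<close>; its zeros there let the end vertices follow the same formula as inner
  ones.\<close>

lemma adjacency_matrix_path_mult:
  fixes g :: "nat \<Rightarrow> real"
  assumes a: "a < n" and g: "g 0 = 0" "g (n + 1) = 0"
  shows "(adjacency_matrix n (path_edges n) *\<^sub>v vec n (\<lambda>b. g (b + 1))) $ a = g a + g (a + 2)"
proof -
  have "(adjacency_matrix n (path_edges n) *\<^sub>v vec n (\<lambda>b. g (b + 1))) $ a =
      (\<Sum>b<n. (if b = a + 1 then g (b + 1) else 0) + (if a = b + 1 then g (b + 1) else 0))"
    using a by (auto simp: scalar_prod_def adjacency_matrix_path_index carrier_matD[OF adjacency_matrix_carrier]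
        atLeast0LessThan intro!: sum.cong)
  also have "\<dots> = (if a + 1 < n then g (a + 2) else 0) + (\<Sum>b<n. if a = b + 1 then g (b + 1) else 0)"
    by (simp add: sum.distrib)
  also have "(\<Sum>b<n. if a = b + 1 then g (b + 1) else 0) = g a"
  proof (cases a)
    case (Suc m)
    then have "(\<Sum>b<n. if a = b + 1 then g (b + 1) else 0) = (\<Sum>b<n. if b = m then g a else 0)"
      by (intro sum.cong) auto
    then show ?thesis using Suc a by simp
  qed (use g in simp)
  also have "(if a + 1 < n then g (a + 2) else 0) = g (a + 2)"
  proof (cases "a + 1 < n")
    case False
    with a have "a + 2 = n + 1" by simp
    with g False show ?thesis by simp
  qed simp
  finally show ?thesis by simp
qed

lemma input_matrix_singleton_carrier: "input_matrix n {i} \<in> carrier_mat n 1"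
  by (rule carrier_matI) (simp_all add: input_matrix_def)

lemma input_matrix_singleton_index:
  "a < n \<Longrightarrow> i \<in> {1..n} \<Longrightarrow> input_matrix n {i} $$ (a, 0) = (if a + 1 = i then 1 else 0)"
  by (auto simp: input_matrix_def mat_of_cols_def)

text \<open>The zeros of the sine wave at \<open>0\<close> and \<open>n + 1\<close> make it an
  eigenvector; the zero at \<open>i\<close> puts it in the kernel of the transposed input
  matrix.\<close>

lemma not_coprime_imp_not_controllable_path:
  assumes i: "i \<in> {1..n}" and "gcd i (n + 1) \<noteq> 1"
  shows "\<not> controllable (adjacency_matrix n (path_edges n)) (input_matrix n {i})"
proof -
  define d where "d = gcd i (n + 1)"
  have "d \<noteq> 0" "d \<noteq> 1" using i assms by (auto simp: d_def)
  then have d: "d \<ge> 2" by simp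
  define s where "s j = sin (real j * (pi / d))" for j :: nat
  have s0: "s j = 0" if "d dvd j" for j
  proof -
    from that obtain m where "j = d * m" ..
    with d have "real j * (pi / d) = real m * pi" by simp
    then show ?thesis unfolding s_def by simp
  qed
  have bd: "s 0 = 0" "s (n + 1) = 0" "s i = 0"
    by (auto intro!: s0 simp: d_def simp del: Suc_eq_plus1)
  \<comment> \<open>Here \<open>d \<ge> 2\<close> enters: it makes the first entry of the wave
    nonzero.\<close>
  have "pi / d > 0" "pi / d < pi" using d by (auto simp: field_simps)
  then have s1: "s 1 > 0" by (simp add: s_def sin_gt_zero)
  let ?v = "vec n (\<lambda>b. s (b + 1))"
  have rec: "s a + s (a + 2) = 2 * cos (pi / d) * s (a + 1)" for a
  proof -
    have "(real a * (pi / d) - real (a + 2) * (pi / d)) / 2 = - (pi / d)"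
      "(real a * (pi / d) + real (a + 2) * (pi / d)) / 2 = real (a + 1) * (pi / d)"
      by (simp_all add: algebra_simps add_divide_distrib diff_divide_distrib)
    then show ?thesis
      unfolding s_def sin_plus_sin by simp
  qed
  show ?thesis
  proof (rule left_eigenvector_imp_not_controllable)
    show "?v \<noteq> 0\<^sub>v n"
    proof
      assume "?v = 0\<^sub>v n"
      then have "?v $ 0 = 0\<^sub>v n $ 0" by simp
      with s1 i show False by simp
    qed
    show "transpose_mat (adjacency_matrix n (path_edges n)) *\<^sub>v ?v = (2 * cos (pi / d)) \<cdot>\<^sub>v ?v"
      unfolding transpose_adjacency_matrix
    proof (rule eq_vecI, goal_cases)
      case (1 a)
      then have "a < n" by simp
      with rec[of a] show ?case
        by (simp only: adjacency_matrix_path_mult[OF _ bd(1,2)]) simp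
    qed (simp add: adjacency_matrix_def)
    show "transpose_mat (input_matrix n {i}) *\<^sub>v ?v = 0\<^sub>v 1"
    proof (rule eq_vecI, goal_cases)
      case (1 a)
      then have "a = 0" by simp
      moreover have "(\<Sum>b<n. input_matrix n {i} $$ (b, 0) * s (b + 1)) = 0"
        using i bd(3) by (intro sum.neutral) (auto simp: input_matrix_singleton_index)
      ultimately show ?case
        using carrier_matD[OF input_matrix_singleton_carrier[of n i]]
        by (simp add: scalar_prod_def atLeast0LessThan)
    qed (simp add: carrier_matD[OF input_matrix_singleton_carrier[of n i]])
  qed (rule adjacency_matrix_carrier input_matrix_singleton_carrier vec_carrier)+
qed

section \<open>Two-point Hermite interpolation\<close>

lemma pderiv_sum: "pderiv (sum f A) = (\<Sum>i\<in>A. pderiv (f i))"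
  using higher_pderiv_sum[of 1 f A] by simp

lemma pderiv_surj: "\<exists>q. pderiv q = p" for p :: "real poly"
proof
  have "pderiv (\<Sum>i\<le>degree p. monom (coeff p i / (i + 1)) (i + 1)) = (\<Sum>i\<le>degree p. monom (coeff p i) i)"
    unfolding pderiv_sum by (intro sum.cong refl) (simp add: pderiv_monom)
  then show "pderiv (\<Sum>i\<le>degree p. monom (coeff p i / (i + 1)) (i + 1)) = p"
    by (simp add: poly_as_sum_of_monoms)
qed

text \<open>Integrate a polynomial with the shifted data, then adjust the constant term.\<close>

lemma exists_poly_jet:
  fixes c :: "nat \<Rightarrow> real"
  shows "\<exists>w. \<forall>k<n. poly ((pderiv ^^ k) w) a = c k"
proof (induction n arbitrary: c)
  case (Suc n)
  from Suc[of "\<lambda>k. c (Suc k)"] obtain w where w: "\<forall>k<n. poly ((pderiv ^^ k) w) a = c (Suc k)" ..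
  obtain q where q: "pderiv q = w" using pderiv_surj by blast
  let ?q = "q + [:c 0 - poly q a:]"
  have "pderiv ?q = w" using q by (simp add: pderiv_add)
  then have "poly ((pderiv ^^ Suc k) ?q) a = c (Suc k)" if "k < n" for k
    using w that by (simp only: funpow_Suc_right o_apply)
  then have "poly ((pderiv ^^ k) ?q) a = c k" if "k < Suc n" for k
    using that by (cases k) auto
  then show ?case by blast
qed simp

text \<open>Each differentiation lowers the multiplicity of the zero at \<open>a\<close> by at most
  one.\<close>

lemma poly_higher_pderiv_eq_0:
  fixes z :: "real poly"
  assumes "[:- a, 1:] ^ n dvd z" "k < n"
  shows "poly ((pderiv ^^ k) z) a = 0"
  using assms
proof (induction n arbitrary: z k)
  case (Suc n)
  from Suc.prems obtain y where y: "z = [:- a, 1:] ^ Suc n * y" by auto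
  show ?case
  proof (cases k)
    case 0
    then show ?thesis by (simp add: y)
  next
    case k: (Suc k)
    have "pderiv z = [:- a, 1:] ^ n * ([:- a, 1:] * pderiv y + smult (of_nat (Suc n)) y)"
      unfolding y by (simp only: pderiv_mult pderiv_power_Suc) (simp add: pderiv_pCons algebra_simps)
    then have "[:- a, 1:] ^ n dvd pderiv z" by simp
    with Suc.IH k Suc.prems show ?thesis by (simp add: funpow_swap1)
  qed
qed simp

lemma higher_pderiv_minus: "(pderiv ^^ k) (p - q) = (pderiv ^^ k) p - (pderiv ^^ k) q" for p :: "real poly"
  by (induction k) (simp_all add: pderiv_diff)

text \<open>Chinese remaindering: one-point solutions \<open>w1\<close> and \<open>w2\<close> are
  combined modulo the coprime powers \<open>[:- a, 1:] ^ n\<close> and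
  \<open>[:- b, 1:] ^ n\<close>.\<close>

lemma hermite_interpolation:
  fixes a b :: real
  assumes "a \<noteq> b"
  shows "\<exists>z. \<forall>k<n. poly ((pderiv ^^ k) z) a = c k \<and> poly ((pderiv ^^ k) z) b = e k"
proof -
  obtain w1 where w1: "\<And>k. k < n \<Longrightarrow> poly ((pderiv ^^ k) w1) a = c k"
    using exists_poly_jet by metis
  obtain w2 where w2: "\<And>k. k < n \<Longrightarrow> poly ((pderiv ^^ k) w2) b = e k"
    using exists_poly_jet by metis
  let ?p = "[:- a, 1:] ^ n" and ?q = "[:- b, 1:] ^ n"
  have "coprime [:- a, 1:] [:- b, 1:]"
  proof (rule coprimeI)
    fix r assume "r dvd [:- a, 1:]" "r dvd [:- b, 1:]"
    then have "r dvd [:- a, 1:] - [:- b, 1:]" by (rule dvd_diff)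
    moreover have "[:- a, 1:] - [:- b, 1:] dvd 1" using assms by (simp add: is_unit_iff_degree)
    ultimately show "is_unit r" by (rule dvd_trans)
  qed
  then have "coprime ?p ?q" by simp
  then obtain x y where xy: "x * ?p + y * ?q = 1"
    by (metis bezout_coefficients_fst_snd coprime_iff_gcd_eq_1)
  \<comment> \<open>The Bezout term \<open>x * ?p\<close> is \<open>0\<close> modulo
    \<open>?p\<close> and \<open>1\<close> modulo \<open>?q\<close>, hence it carries
    \<open>w2\<close>.\<close>
  define z where "z = x * ?p * w2 + y * ?q * w1"
  have "z - w1 = x * ?p * w2 + (y * ?q - 1) * w1" by (simp add: z_def algebra_simps)
  also have "y * ?q - 1 = - (x * ?p)" using xy by (simp add: algebra_simps)
  finally have "z - w1 = ?p * (x * (w2 - w1))" by (simp add: algebra_simps)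
  then have 1: "?p dvd z - w1" by (metis dvd_triv_left)
  have "z - w2 = (x * ?p - 1) * w2 + y * ?q * w1" by (simp add: z_def algebra_simps)
  also have "x * ?p - 1 = - (y * ?q)" using xy by (simp add: algebra_simps)
  finally have "z - w2 = ?q * (y * (w1 - w2))" by (simp add: algebra_simps)
  then have 2: "?q dvd z - w2" by (metis dvd_triv_left)
  show ?thesis
    using poly_higher_pderiv_eq_0[OF 1] poly_higher_pderiv_eq_0[OF 2] w1 w2
    by (intro exI[of _ z]) (auto simp: higher_pderiv_minus)
qed

section \<open>Characteristic polynomials of paths\<close>

text \<open>\<open>path_poly (k + 1)\<close> is the characteristic polynomial of the path on \<open>k\<close> vertices.\<close>

fun path_poly :: "nat \<Rightarrow> real poly" where
  "path_poly 0 = 0"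
| "path_poly (Suc 0) = 1"
| "path_poly (Suc (Suc k)) = pCons 0 (path_poly (Suc k)) - path_poly k"

lemma degree_path_poly_le: "degree (path_poly k) \<le> k - 1"
proof (induction k rule: path_poly.induct)
  case (3 k)
  then have "degree (pCons 0 (path_poly (Suc k))) \<le> Suc k"
    by (metis Suc_diff_1 Suc_le_mono degree_pCons_le diff_Suc_1 le_trans zero_less_Suc)
  moreover have "degree (path_poly k) \<le> Suc k" using 3 by simp
  ultimately show ?case by (simp add: degree_diff_le)
qed auto

lemma coeff_path_poly_top: "coeff (path_poly (Suc k)) k = 1"
proof (induction k rule: less_induct)
  case (less k)
  show ?case
  proof (cases k)
    case (Suc m)
    have "degree (path_poly m) < Suc m"
      using degree_path_poly_le[of m] by simp
    with less[of m] Suc show ?thesis by (simp add: coeff_eq_0)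
  qed simp
qed

lemma path_poly_nonzero: "k > 0 \<Longrightarrow> path_poly k \<noteq> 0"
  by (metis Suc_pred coeff_0 coeff_path_poly_top zero_neq_one)

lemma degree_path_poly: "degree (path_poly (Suc k)) = k"
  using degree_path_poly_le[of "Suc k"] le_degree[of "path_poly (Suc k)" k] coeff_path_poly_top[of k]
  by simp

text \<open>Analogue of the Fibonacci addition formula; for positive \<open>m\<close> and
  \<open>k\<close> it expresses the cutting of the edge between the first \<open>m\<close> and the
  last \<open>k\<close> vertices.\<close>

lemma path_poly_add:
  "path_poly (m + k + 1) = path_poly (m + 1) * path_poly (k + 1) - path_poly m * path_poly k"
proof (induction k rule: path_poly.induct)
  case 2
  have "path_poly (m + 2) = pCons 0 (path_poly (Suc m)) - path_poly m" by simp
  then show ?case by simp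
next
  case (3 k)
  have "path_poly (m + Suc (Suc k) + 1) = pCons 0 (path_poly (m + Suc k + 1)) - path_poly (m + k + 1)"
    by simp
  also have "\<dots> = path_poly (m + 1) * (pCons 0 (path_poly (Suc k + 1)) - path_poly (k + 1))
      - path_poly m * (pCons 0 (path_poly (Suc k)) - path_poly k)"
    unfolding 3 by (simp add: algebra_simps)
  finally show ?case by simp
qed simp

text \<open>By the recurrence, a common divisor of two consecutive terms divides the preceding one
  as well.\<close>

lemma coprime_path_poly_Suc: "coprime (path_poly k) (path_poly (Suc k))"
proof (induction k)
  case (Suc k)
  show ?case
  proof (rule coprimeI)
    fix r assume r: "r dvd path_poly (Suc k)" "r dvd path_poly (Suc (Suc k))"
    have "path_poly k = [:0, 1:] * path_poly (Suc k) - path_poly (Suc (Suc k))" by simp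
    then have "r dvd path_poly k" using r by (metis dvd_diff dvd_mult)
    with r Suc show "is_unit r" using coprime_common_divisor by blast
  qed
qed simp

text \<open>Modulo \<open>path_poly a\<close>, the addition formula leaves
  \<open>path_poly (a + 1) * path_poly b\<close>, and both factors are coprime to
  \<open>path_poly a\<close>.\<close>

lemma coprime_path_poly_add:
  assumes "coprime (path_poly a) (path_poly b)"
  shows "coprime (path_poly a) (path_poly (a + b))"
proof (cases b)
  case (Suc k)
  have eq: "path_poly (a + b) = path_poly (a + 1) * path_poly b - path_poly a * path_poly k"
    using path_poly_add[of a k] Suc by simp
  have c: "coprime (path_poly a) (path_poly (a + 1) * path_poly b)"
    using assms coprime_path_poly_Suc[of a] by simp
  show ?thesis
  proof (rule coprimeI)
    fix r assume r: "r dvd path_poly a" "r dvd path_poly (a + b)"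
    then have "r dvd path_poly (a + b) + path_poly a * path_poly k" by simp
    then have "r dvd path_poly (a + 1) * path_poly b" by (simp add: eq)
    with r c show "is_unit r" using coprime_common_divisor by blast
  qed
qed (use assms in simp)

lemma coprime_diff_nat: "a \<le> b \<Longrightarrow> coprime a (b - a) \<longleftrightarrow> coprime a b" for a b :: nat
  by (metis coprime_iff_gcd_eq_1 gcd.commute gcd_diff1_nat)

text \<open>Euclid's algorithm by subtraction, run on the indices.\<close>

lemma coprime_path_poly: "coprime a b \<Longrightarrow> coprime (path_poly a) (path_poly b)"
proof (induction "a + b" arbitrary: a b rule: less_induct)
  case less
  consider "a = 0" | "b = 0" | "0 < a" "a \<le> b" | "0 < b" "b \<le> a" by linarith
  then show ?case
  proof cases
    case 3
    with less.prems have "coprime a (b - a)"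
      by (simp add: coprime_diff_nat)
    with less.hyps[of a "b - a"] 3 have "coprime (path_poly a) (path_poly (a + (b - a)))"
      by (intro coprime_path_poly_add) auto
    with 3 show ?thesis by simp
  next
    case 4
    with less.prems have "coprime b (a - b)"
      by (simp add: coprime_diff_nat coprime_commute)
    with less.hyps[of b "a - b"] 4 have "coprime (path_poly b) (path_poly (b + (a - b)))"
      by (intro coprime_path_poly_add) auto
    with 4 show ?thesis by (simp add: coprime_commute)
  qed (use less.prems in auto)
qed

lemma path_poly_sum_degree:
  "degree (\<Sum>j=1..m. smult (v j) (path_poly j)) \<le> m - 1"
  using degree_path_poly_le by (intro degree_sum_le) (auto intro!: order.trans[OF degree_smult_le] order.trans[OF degree_path_poly_le])

text \<open>The degrees are distinct: in order \<open>m\<close> only the monic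
  \<open>path_poly (Suc m)\<close> contributes, which isolates \<open>v (Suc m)\<close>.\<close>

lemma path_poly_independent:
  assumes "(\<Sum>j=1..m. smult (v j) (path_poly j)) = 0" "j \<in> {1..m}"
  shows "v j = 0"
  using assms
proof (induction m)
  case (Suc m)
  have "coeff (\<Sum>j=1..Suc m. smult (v j) (path_poly j)) m =
      coeff (\<Sum>j=1..m. smult (v j) (path_poly j)) m + v (Suc m)"
    by (simp add: coeff_path_poly_top)
  moreover have "coeff (\<Sum>j=1..m. smult (v j) (path_poly j)) m = 0"
  proof (cases m)
    case (Suc k)
    with path_poly_sum_degree[of v m] show ?thesis by (intro coeff_eq_0) simp
  qed simp
  ultimately have "v (Suc m) = 0" using Suc.prems(1) by (metis add_0 coeff_0)
  with Suc show ?case by (cases "j = Suc m") auto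
qed simp

section \<open>Differential operators with constant coefficients\<close>

definition diff_op :: "real poly \<Rightarrow> real poly \<Rightarrow> real poly" where
  "diff_op p z = (\<Sum>k\<le>degree p. smult (coeff p k) ((pderiv ^^ k) z))"

text \<open>A common summation range lets operators of different degrees be added.\<close>

lemma diff_op_eq:
  assumes "degree p < n"
  shows "diff_op p z = (\<Sum>k<n. smult (coeff p k) ((pderiv ^^ k) z))"
  unfolding diff_op_def using assms
  by (intro sum.mono_neutral_left) (auto simp: coeff_eq_0)

lemma diff_op_0 [simp]: "diff_op 0 z = 0"
  by (simp add: diff_op_def)

lemma diff_op_add: "diff_op (p + q) z = diff_op p z + diff_op q z"
proof -
  define N where "N = Suc (max (degree p) (degree q))"
  have "degree p < N" "degree q < N" "degree (p + q) < N"
    using degree_add_le_max[of p q] by (auto simp: N_def)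
  then show ?thesis by (simp add: diff_op_eq smult_add_left sum.distrib)
qed

text \<open>This turns polynomial recurrences into differential equations.\<close>

lemma diff_op_pCons_0: "diff_op (pCons 0 p) z = pderiv (diff_op p z)"
proof -
  have "diff_op (pCons 0 p) z = (\<Sum>k<Suc (Suc (degree p)). smult (coeff (pCons 0 p) k) ((pderiv ^^ k) z))"
    using degree_pCons_le[of 0 p] by (intro diff_op_eq) simp
  also have "\<dots> = (\<Sum>k\<le>degree p. smult (coeff p k) ((pderiv ^^ Suc k) z))"
    by (subst sum.lessThan_Suc_shift) (simp add: lessThan_Suc_atMost)
  finally show ?thesis by (simp add: diff_op_def pderiv_sum pderiv_smult)
qed

section \<open>Controllability of the path\<close>

text \<open>
  For \<open>1 \<le> j \<le> n\<close>, this is the entry \<open>(j, i)\<close> of the adjugate of \<open>sI - A\<close>; the definition extends it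
  by \<open>0\<close> to \<open>j = 0\<close> and \<open>j = n + 1\<close>.
\<close>

definition path_adjugate :: "nat \<Rightarrow> nat \<Rightarrow> nat \<Rightarrow> real poly" where
  "path_adjugate n i j = path_poly (min i j) * path_poly (n + 1 - max i j)"

lemma path_adjugate_eq:
  "j \<le> i \<Longrightarrow> path_adjugate n i j = path_poly j * path_poly (n + 1 - i)"
  "i \<le> j \<Longrightarrow> path_adjugate n i j = path_poly i * path_poly (n + 1 - j)"
  by (simp_all add: path_adjugate_def min_def max_def)

text \<open>Hence the state at a given time depends only on the derivatives of \<open>z\<close> of
  order less than \<open>n\<close>.\<close>

lemma degree_path_adjugate:
  assumes "i \<in> {1..n}" "j \<in> {1..n}"
  shows "degree (path_adjugate n i j) < n"
proof -
  have "degree (path_adjugate n i j) \<le> (min i j - 1) + (n + 1 - max i j - 1)"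
    unfolding path_adjugate_def
    by (intro order.trans[OF degree_mult_le] add_mono degree_path_poly_le)
  also have "\<dots> < n" using assms by auto
  finally show ?thesis .
qed

text \<open>Column \<open>i\<close> of \<open>(sI - A) adj(sI - A) = p I\<close>. Away from vertex
  \<open>i\<close> one factor follows the recurrence of \<open>path_poly\<close>; at
  \<open>i\<close> the addition formula produces \<open>p\<close>.\<close>

lemma path_adjugate_rec:
  assumes i: "i \<in> {1..n}" and a: "a < n"
  shows "pCons 0 (path_adjugate n i (a + 1)) =
    path_adjugate n i a + path_adjugate n i (a + 2) + (if a + 1 = i then path_poly (n + 1) else 0)"
proof -
  have rec: "pCons 0 (path_poly (Suc k)) = path_poly k + path_poly (Suc (Suc k))" for k
    by simp
  have pm: "pCons 0 (p * q) = pCons 0 p * q" "pCons 0 (p * q) = p * pCons 0 q" for p q :: "real poly"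
    by simp_all
  consider "a + 1 < i" | "a + 1 > i" | "a + 1 = i" by linarith
  then show ?thesis
  proof cases
    case 1
    then show ?thesis
      using pm(1)[of "path_poly (Suc a)" "path_poly (n + 1 - i)"] rec[of a]
      by (simp add: path_adjugate_eq(1) algebra_simps del: path_poly.simps mult_pCons_left mult_pCons_right)
  next
    case 2
    \<comment> \<open>\<open>m\<close> counts the vertices to the right of vertex
      \<open>a + 1\<close>.\<close>
    obtain m where m: "n = a + m + 1" using a less_imp_Suc_add by fastforce
    from 2 show ?thesis
      using pm(2)[of "path_poly i" "path_poly (Suc m)"] rec[of m]
      by (simp add: path_adjugate_eq(2) m algebra_simps Suc_diff_le del: path_poly.simps mult_pCons_left mult_pCons_right)
  next
    case 3
    obtain m where m: "n = a + m + 1" using a less_imp_Suc_add by fastforce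
    have "path_poly (n + 1) = path_poly (Suc (Suc a)) * path_poly (Suc m) - path_poly (Suc a) * path_poly m"
      using path_poly_add[of "a + 1" m] m by (simp add: ac_simps del: path_poly.simps)
    with 3[symmetric] show ?thesis
      using pm(1)[of "path_poly (Suc a)" "path_poly (Suc m)"] rec[of a]
      by (simp add: path_adjugate_eq m algebra_simps del: path_poly.simps mult_pCons_left mult_pCons_right)
  qed
qed

text \<open>
  A vanishing linear combination splits at \<open>i\<close> as \<open>a q + p b\<close> with \<open>p\<close>, \<open>q\<close> coprime and
  \<open>deg b < deg q\<close>, so both parts vanish.
\<close>

lemma path_adjugate_independent:
  assumes i: "i \<in> {1..n}" and cop: "coprime i (n + 1)"
    and sum: "(\<Sum>j=1..n. smult (v j) (path_adjugate n i j)) = 0" and j: "j \<in> {1..n}"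
  shows "v j = 0"
proof -
  let ?p = "path_poly i" and ?q = "path_poly (n + 1 - i)"
  define a where "a = (\<Sum>j=1..i. smult (v j) (path_poly j))"
  define b where "b = (\<Sum>j=1..n-i. smult (v (n + 1 - j)) (path_poly j))"
  have "coprime i (n + 1 - i)"
    using cop i by (simp add: coprime_diff_nat)
  then have pq: "coprime ?p ?q" by (rule coprime_path_poly)
  have b': "b = (\<Sum>j=i+1..n. smult (v j) (path_poly (n + 1 - j)))"
    unfolding b_def using i
    by (intro sum.reindex_bij_witness[of _ "\<lambda>j. n + 1 - j" "\<lambda>j. n + 1 - j"]) auto
  have "{1..n} = {1..i} \<union> {i+1..n}" using i by auto
  then have "(\<Sum>j=1..n. smult (v j) (path_adjugate n i j)) =
      (\<Sum>j=1..i. smult (v j) (path_adjugate n i j)) + (\<Sum>j=i+1..n. smult (v j) (path_adjugate n i j))"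
    by (simp add: sum.union_disjoint)
  also have "(\<Sum>j=1..i. smult (v j) (path_adjugate n i j)) = a * ?q"
    unfolding a_def sum_distrib_right by (intro sum.cong) (auto simp: path_adjugate_eq)
  also have "(\<Sum>j=i+1..n. smult (v j) (path_adjugate n i j)) = ?p * b"
    unfolding b' sum_distrib_left by (intro sum.cong) (auto simp: path_adjugate_eq)
  finally have eq: "a * ?q + ?p * b = 0" using sum by simp
  then have "?p * b = - a * ?q" by (simp add: add_eq_0_iff)
  then have "?q dvd ?p * b" by simp
  with pq have dvd: "?q dvd b" by (simp add: coprime_commute coprime_dvd_mult_right_iff)
  have b0: "b = 0"
  \<comment> \<open>For \<open>i = n\<close> the degree comparison would fail, as
    \<open>?q = 1\<close>, but \<open>b\<close> is then an empty sum.\<close>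
  proof (cases "i = n")
    case False
    have "degree b \<le> n - i - 1" unfolding b_def by (rule path_poly_sum_degree)
    moreover have "degree ?q = n - i" using degree_path_poly[of "n - i"] i by (simp add: Suc_diff_le)
    moreover have "i < n" using False i by auto
    ultimately have "degree b < degree ?q" by linarith
    with dvd show ?thesis using dvd_imp_degree_le[of ?q b] by fastforce
  qed (simp add: b_def)
  have "?q \<noteq> 0" using i by (intro path_poly_nonzero) auto
  with eq b0 have a0: "a = 0" by simp
  show ?thesis
  proof (cases "j \<le> i")
    case True
    then show ?thesis using path_poly_independent[of v i j] a0 j by (simp add: a_def)
  next
    case False
    with j have "n + 1 - j \<in> {1..n - i}" "n + 1 - (n + 1 - j) = j" by auto
    then show ?thesis
      using path_poly_independent[of "\<lambda>j. v (n + 1 - j)" "n - i" "n + 1 - j"] b0 unfolding b_def by metis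
  qed
qed

lemma surj_mult_mat_vec:
  fixes F :: "'a :: field mat"
  assumes F: "F \<in> carrier_mat n n"
    and ker: "\<And>v. v \<in> carrier_vec n \<Longrightarrow> transpose_mat F *\<^sub>v v = 0\<^sub>v n \<Longrightarrow> v = 0\<^sub>v n"
    and y: "y \<in> carrier_vec n"
  shows "\<exists>c\<in>carrier_vec n. F *\<^sub>v c = y"
proof -
  have "det (transpose_mat F) \<noteq> 0"
    using ker F by (subst det_0_iff_vec_prod_zero) auto
  with F have "det F \<noteq> 0" by (simp add: det_transpose)
  \<comment> \<open>\<open>undefined\<close> merely instantiates the extension slot of the record
    \<open>ring_mat\<close>.\<close>
  from det_non_zero_imp_unit[OF F this, of undefined]
  obtain G where G: "G \<in> carrier_mat n n" "F * G = 1\<^sub>m n"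
    unfolding Units_def ring_mat_def by auto
  have "F *\<^sub>v (G *\<^sub>v y) = y"
    using assoc_mult_mat_vec[OF F G(1) y] G y by simp
  with G y show ?thesis by (intro bexI[of _ "G *\<^sub>v y"]) auto
qed

text \<open>\<open>c k\<close> will be the value of the \<open>k\<close>-th derivative of
  \<open>z\<close>. The coefficient matrix is square with independent rows, so it is
  invertible.\<close>

lemma exists_path_adjugate_jet:
  assumes i: "i \<in> {1..n}" and cop: "coprime i (n + 1)" and y: "y \<in> carrier_vec n"
  shows "\<exists>c. \<forall>a<n. (\<Sum>k<n. coeff (path_adjugate n i (a + 1)) k * c k) = y $ a"
proof -
  let ?F = "mat n n (\<lambda>(a, k). coeff (path_adjugate n i (a + 1)) k)"
  have "\<exists>c\<in>carrier_vec n. ?F *\<^sub>v c = y"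
  proof (rule surj_mult_mat_vec)
    fix v assume v: "v \<in> carrier_vec n" and Fv: "transpose_mat ?F *\<^sub>v v = 0\<^sub>v n"
    have coeff0: "(\<Sum>a<n. coeff (path_adjugate n i (a + 1)) k * v $ a) = 0" if "k < n" for k
    proof -
      have "(transpose_mat ?F *\<^sub>v v) $ k = 0" using Fv that by simp
      with that v show ?thesis by (simp add: scalar_prod_def atLeast0LessThan)
    qed
    \<comment> \<open>A kernel vector of the transpose is a linear relation between the adjugate
      entries.\<close>
    let ?s = "\<Sum>j=1..n. smult (v $ (j - 1)) (path_adjugate n i j)"
    have s: "coeff ?s k = (\<Sum>a<n. coeff (path_adjugate n i (a + 1)) k * v $ a)" for k
      unfolding coeff_sum
      by (rule sum.reindex_bij_witness[of _ "\<lambda>a. a + 1" "\<lambda>j. j - 1"]) auto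
    have "?s = 0"
    proof (rule poly_eqI)
      fix k
      show "coeff ?s k = coeff 0 k"
      proof (cases "k < n")
        case False
        then have "coeff (path_adjugate n i (a + 1)) k = 0" if "a < n" for a
          using degree_path_adjugate[OF i, of "a + 1"] that by (intro coeff_eq_0) auto
        then show ?thesis unfolding s by simp
      qed (use coeff0 s in simp)
    qed
    from path_adjugate_independent[OF i cop this] have "v $ (j - 1) = 0" if "j \<in> {1..n}" for j
      using that by simp
    from this[of "Suc _"] show "v = 0\<^sub>v n" using v by (intro eq_vecI) auto
  qed (use y in auto)
  then obtain c where "c \<in> carrier_vec n" "?F *\<^sub>v c = y" by blast
  then show ?thesis
    by (intro exI[of _ "\<lambda>k. c $ k"]) (auto simp: scalar_prod_def atLeast0LessThan)
qed

lemma coprime_imp_controllable_path: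
  assumes i: "i \<in> {1..n}" and cop: "coprime i (n + 1)"
  shows "controllable (adjacency_matrix n (path_edges n)) (input_matrix n {i})"
    (is "controllable ?A ?B")
  unfolding controllable_def
proof (intro ballI)
  note dims = carrier_matD[OF adjacency_matrix_carrier[of n "path_edges n"]]
    carrier_matD[OF input_matrix_singleton_carrier[of n i]]
  fix x0 x1 :: "real vec"
  assume "x0 \<in> carrier_vec (dim_row ?A)" "x1 \<in> carrier_vec (dim_row ?A)"
  then have x01: "x0 \<in> carrier_vec n" "x1 \<in> carrier_vec n" by (simp_all add: dims)
  let ?f = "path_adjugate n i"
  obtain c where c: "\<And>a. a < n \<Longrightarrow> (\<Sum>k<n. coeff (?f (a + 1)) k * c k) = x0 $ a"
    using exists_path_adjugate_jet[OF i cop x01(1)] by blast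
  obtain e where e: "\<And>a. a < n \<Longrightarrow> (\<Sum>k<n. coeff (?f (a + 1)) k * e k) = x1 $ a"
    using exists_path_adjugate_jet[OF i cop x01(2)] by blast
  obtain z where z: "\<And>k. k < n \<Longrightarrow> poly ((pderiv ^^ k) z) 0 = c k"
      "\<And>k. k < n \<Longrightarrow> poly ((pderiv ^^ k) z) 1 = e k"
    using hermite_interpolation[of 0 1 n c e] by auto
  define x where "x t = vec n (\<lambda>a. poly (diff_op (?f (a + 1)) z) t)" for t
  define u where "u t = vec 1 (\<lambda>_. poly (diff_op (path_poly (n + 1)) z) t)" for t
  have fz: "poly (diff_op (?f (a + 1)) z) t = (\<Sum>k<n. coeff (?f (a + 1)) k * poly ((pderiv ^^ k) z) t)"
    if "a < n" for a t
    using degree_path_adjugate[OF i, of "a + 1"] that by (simp add: diff_op_eq poly_sum)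
  have "poly (diff_op (?f (a + 1)) z) 0 = x0 $ a" "poly (diff_op (?f (a + 1)) z) 1 = x1 $ a"
    if "a < n" for a
    using z c[OF that] e[OF that] unfolding fz[OF that] by simp_all
  then have "x 0 = x0" "x 1 = x1"
    by (intro eq_vecI; use x01 in \<open>simp add: x_def\<close>)+
  moreover have "admissible_control (dim_col ?B) 1 u"
    using continuous_on_poly[OF continuous_on_id] by (auto simp: admissible_control_def u_def dims)
  moreover have "trajectory ?A ?B 1 u x"
    unfolding trajectory_def dims
  proof (intro ballI conjI allI impI)
    fix t :: real and a assume a: "a < n"
    let ?g = "\<lambda>j. poly (diff_op (?f j) z) t"
    \<comment> \<open>\<open>?g\<close> vanishes at \<open>0\<close> and \<open>n + 1\<close>
      because \<open>path_poly 0 = 0\<close>.\<close>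
    have "(?A *\<^sub>v x t) $ a = ?g a + ?g (a + 2)"
      unfolding x_def using a i
      by (intro adjacency_matrix_path_mult) (auto simp: path_adjugate_eq)
    moreover have "(?B *\<^sub>v u t) $ a = (if a + 1 = i then poly (diff_op (path_poly (n + 1)) z) t else 0)"
      using a i by (simp add: u_def scalar_prod_def dims input_matrix_singleton_index)
    moreover have "(?A *\<^sub>v x t + ?B *\<^sub>v u t) $ a = (?A *\<^sub>v x t) $ a + (?B *\<^sub>v u t) $ a"
      using a by (intro index_add_vec) (simp add: dims)
    \<comment> \<open>The adjugate recurrence, read as operators applied to \<open>z\<close>, is the
      state equation.\<close>
    moreover have "poly (pderiv (diff_op (?f (a + 1)) z)) t =
        ?g a + ?g (a + 2) + (if a + 1 = i then poly (diff_op (path_poly (n + 1)) z) t else 0)"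
      unfolding diff_op_pCons_0[symmetric] path_adjugate_rec[OF i a]
      by (simp add: diff_op_add)
    ultimately have "(?A *\<^sub>v x t + ?B *\<^sub>v u t) $ a = poly (pderiv (diff_op (?f (a + 1)) z)) t"
      by (simp only:)
    moreover have "(\<lambda>s. x s $ a) = poly (diff_op (?f (a + 1)) z)"
      using a by (simp add: x_def)
    ultimately show "((\<lambda>s. x s $ a) has_real_derivative (?A *\<^sub>v x t + ?B *\<^sub>v u t) $ a) (at t within {0..1})"
      by (simp only: has_field_derivative_at_within[OF poly_DERIV])
  qed (simp add: x_def)
  moreover have "(0 :: real) < 1" by simp
  ultimately show "\<exists>T>0. \<exists>u x. admissible_control (dim_col ?B) T u \<and> trajectory ?A ?B T u x \<and>
      x 0 = x0 \<and> x T = x1"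
    by metis
qed

section \<open>Minimal driver sets and their number\<close>

lemma driver_set_path_singleton:
  assumes "i \<in> {1..n}"
  shows "driver_set n (path_edges n) {i} \<longleftrightarrow> gcd i (n + 1) = 1"
  using coprime_imp_controllable_path[OF assms] not_coprime_imp_not_controllable_path[OF assms] assms
  unfolding driver_set_def coprime_iff_gcd_eq_1
  by (metis empty_subsetI insert_not_empty insert_subset)

text \<open>Driver sets are nonempty, so \<open>1\<close> is a lower bound; as subsets of
  \<open>{1..n}\<close> they are finitely many, so \<open>Min\<close> is a true minimum.\<close>

lemma min_driver_card_eq_1:
  assumes "driver_set n E {i}"
  shows "min_driver_card n E = 1"
proof -
  have sub: "S \<subseteq> {1..n} \<and> S \<noteq> {}" if "driver_set n E S" for S
    using that by (simp add: driver_set_def)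
  then have "{S. driver_set n E S} \<subseteq> Pow {1..n}" by blast
  then have "finite {S. driver_set n E S}" by (rule finite_subset) simp
  moreover have "1 \<le> card S" if "driver_set n E S" for S
    using sub[OF that] finite_subset[of S "{1..n}"] by (simp add: Suc_le_eq card_gt_0_iff)
  ultimately show ?thesis
    unfolding min_driver_card_def using image_eqI[of 1 card "{i}"] assms by (intro Min_eqI) auto
qed

theorem theorem15:
  fixes n :: nat
  assumes "n \<ge> 1"
  shows "(\<forall>i\<in>{1..n}. driver_set n (path_edges n) {i} \<longleftrightarrow> gcd i (n + 1) = 1) \<and>
         num_minimal_driver_sets n (path_edges n) = totient (n + 1)"
proof
  show drv: "\<forall>i\<in>{1..n}. driver_set n (path_edges n) {i} \<longleftrightarrow> gcd i (n + 1) = 1"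
    by (intro ballI driver_set_path_singleton)
  then have "driver_set n (path_edges n) {1}" using assms by simp
  then have "min_driver_card n (path_edges n) = 1" by (rule min_driver_card_eq_1)
  then have "{S. minimal_driver_set n (path_edges n) S} = {S. driver_set n (path_edges n) S \<and> card S = 1}"
    by (simp add: minimal_driver_set_def)
  also have "\<dots> = (\<lambda>i. {i}) ` totatives (n + 1)"
  proof (intro equalityI subsetI)
    fix S assume "S \<in> {S. driver_set n (path_edges n) S \<and> card S = 1}"
    then obtain i where i: "S = {i}" "driver_set n (path_edges n) {i}"
      by (auto simp: card_1_singleton_iff)
    then have "i \<in> {1..n}" by (simp add: driver_set_def)
    with drv i show "S \<in> (\<lambda>i. {i}) ` totatives (n + 1)"
      by (auto simp: in_totatives_iff coprime_iff_gcd_eq_1)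
  next
    fix S assume "S \<in> (\<lambda>i. {i}) ` totatives (n + 1)"
    then obtain i where i: "S = {i}" "i > 0" "i \<le> n + 1" "coprime i (n + 1)"
      by (auto simp: in_totatives_iff)
    \<comment> \<open>\<open>totatives (n + 1)\<close> ranges up to \<open>n + 1\<close>, which is
      not coprime to itself since \<open>n \<ge> 1\<close>.\<close>
    with assms have "i \<noteq> n + 1" by auto
    with i drv show "S \<in> {S. driver_set n (path_edges n) S \<and> card S = 1}"
      by (auto simp: coprime_iff_gcd_eq_1)
  qed
  finally have "num_minimal_driver_sets n (path_edges n) = card ((\<lambda>i. {i}) ` totatives (n + 1))"
    by (simp add: num_minimal_driver_sets_def)
  also have "\<dots> = totient (n + 1)"
    by (simp add: card_image totient_def)
  finally show "num_minimal_driver_sets n (path_edges n) = totient (n + 1)" .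
qed

end
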